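(* Suppose each $f_i$, $i\in\{0,\dots,m\}$, is continuously differentiable with $L_i$-Lipschitz continuous gradient on $\mathbb{R}^n$, $L_i>0$, and that at every iterate the gradient estimates satisfy $\|\nabla f_i(x^k)-\widehat{\nabla f}_i(x^k)\|\le\epsilon_i$, $i\in\{0,\dots,m\}$. Assume $\alpha>0$, $w_i>0$ for all $i\in\{1,\dots,m\}$, and $\beta,\gamma_1,\gamma_2\in(0,1)$. Let $\{x^k\}_{k\ge 0}$ be generated by the safe sequential SOCP method with line search (described in the context) from a strictly feasible point $x^0$, i.e. $f_i(x^0)<0$ for all $i\in\{1,\dots,m\}$, with search directions $u(x^k)$. Let $$t_{\min}=\beta\,\min\Big\{\frac{2(1-\gamma_1)}{L_0},\ \min_{1\le i\le m}\frac{2w_i}{L_i},\ \frac{\gamma_2}{\alpha},\ t_{\mathrm{init}}\Big\}.$$ Then every iterate is strictly feasible, and $$f_i(x^K)\le(1-\gamma_2)^K f_i(x^0)<0,\qquad i\in\{1,\dots,m\},\ K\ge 0.$$ Moreover, for every $K\ge 1$, $$\frac1K\sum_{k=0}^{K-1}\|u(x^k)\|^2\le\frac{f_0(x^0)-f^\star}{\gamma_1 t_{\min}K}.$$ In particular, $$\sum_{k=0}^{\infty}\|u(x^k)\|^2\le\frac{f_0(x^0)-f^\star}{\gamma_1 t_{\min}}<\infty,$$ and hence $\lim_{k\to\infty}\|u(x^k)\|=0$.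
   Context: $\|\cdot\|$ is the Euclidean norm. The underlying problem is $f^\star=\min_x\{f_0(x)\ :\ f_i(x)\le 0,\ i\in\{1,\dots,m\}\}$, $f_0,\dots,f_m:\mathbb{R}^n\to\mathbb{R}$, with $f^\star>-\infty$ attained at some feasible point. The error bounds $\epsilon_0,\dots,\epsilon_m>0$ and the initial step size $t_{\mathrm{init}}>0$ are fixed. The function values are evaluated exactly, and the gradient estimates may vary arbitrarily between iterations subject to the error bounds. Standing assumption (MFCQ): for every feasible $x$ there is $d\in\mathbb{R}^n$ with $\nabla f_i(x)^\top d<0$ for all $i\in\{1,\dots,m\}$ with $f_i(x)=0$. The method (safe sequential SOCP with line search). For $k=0,1,2,\dots$: (1) Given $x^k$ and gradient estimates $\widehat{\nabla f}_0(x^k),\dots,\widehat{\nabla f}_m(x^k)\in\mathbb{R}^n$, let $u(x^k)$ be the optimizer of $$\min_{u\in\mathbb{R}^n}\ \tfrac12\|u\|^2+\widehat{\nabla f}_0(x^k)^\top u+\epsilon_0\|u\|\quad\text{s.t.}\quad \widehat{\nabla f}_i(x^k)^\top u+\epsilon_i\|u\|+\alpha f_i(x^k)+w_i\|u\|^2\le 0,\quad i\in\{1,\dots,m\}.$$ (2) Backtracking: let $t^k=\beta^j t_{\mathrm{init}}$ for the smallest integer $j\ge 0$ such that $t=t^k$ satisfies both $$f_0(x^k+t\,u(x^k))\le f_0(x^k)-\gamma_1 t\|u(x^k)\|^2\quad\text{and}\quad f_i(x^k+t\,u(x^k))\le(1-\gamma_2)f_i(x^k)\ \text{ for all } i\in\{1,\dots,m\}.$$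 (3) Set $x^{k+1}=x^k+t^k u(x^k)$. The method is run indefinitely, without an iteration cap or stopping test, producing an infinite sequence $\{x^k\}_{k\ge0}$. *)

theory Defs
  imports "HOL-Analysis.Analysis"
begin

text \<open>Index 0 is the objective, indices 1 to m are the constraints.\<close>

definition feasible_set :: "nat \<Rightarrow> (nat \<Rightarrow> 'a \<Rightarrow> real) \<Rightarrow> 'a set" where
  "feasible_set m f = {x. \<forall>i\<in>{1..m}. f i x \<le> 0}"

definition strictly_feasible :: "nat \<Rightarrow> (nat \<Rightarrow> 'a \<Rightarrow> real) \<Rightarrow> 'a \<Rightarrow> bool" where
  "strictly_feasible m f x \<longleftrightarrow> (\<forall>i\<in>{1..m}. f i x < 0)"

text \<open>As \<open>Inf\<close> on \<^typ>\<open>real\<close> is unspecified for sets that are empty or unbounded below, this is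
  only used together with boundedness and attainment.\<close>

definition opt_value :: "nat \<Rightarrow> (nat \<Rightarrow> 'a \<Rightarrow> real) \<Rightarrow> real" where
  "opt_value m f = (INF x\<in>feasible_set m f. f 0 x)"

definition mfcq ::
  "nat \<Rightarrow> (nat \<Rightarrow> real ^ 'n \<Rightarrow> real) \<Rightarrow> (nat \<Rightarrow> real ^ 'n \<Rightarrow> real ^ 'n) \<Rightarrow> bool" where
  "mfcq m f grad \<longleftrightarrow>
     (\<forall>x\<in>feasible_set m f. \<exists>d. \<forall>i\<in>{1..m}. f i x = 0 \<longrightarrow> grad i x \<bullet> d < 0)"

text \<open>In the subproblem at \<open>x\<close>, \<open>g i\<close> is the estimate of the gradient of \<open>f i\<close> at \<open>x\<close>.\<close>

definition subproblem_objective ::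
  "(nat \<Rightarrow> real) \<Rightarrow> (nat \<Rightarrow> real ^ 'n) \<Rightarrow> real ^ 'n \<Rightarrow> real" where
  "subproblem_objective \<epsilon> g u = 1 / 2 * (norm u)\<^sup>2 + g 0 \<bullet> u + \<epsilon> 0 * norm u"

definition subproblem_feasible ::
  "nat \<Rightarrow> (nat \<Rightarrow> real ^ 'n \<Rightarrow> real) \<Rightarrow> (nat \<Rightarrow> real) \<Rightarrow> real \<Rightarrow> (nat \<Rightarrow> real)
     \<Rightarrow> (nat \<Rightarrow> real ^ 'n) \<Rightarrow> real ^ 'n \<Rightarrow> real ^ 'n \<Rightarrow> bool" where
  "subproblem_feasible m f \<epsilon> \<alpha> w g x u \<longleftrightarrow>
     (\<forall>i\<in>{1..m}. g i \<bullet> u + \<epsilon> i * norm u + \<alpha> * f i x + w i * (norm u)\<^sup>2 \<le> 0)"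

text \<open>For \<open>\<epsilon> i, w i \<ge> 0\<close> the objective is strongly convex and the constraint set is closed and
  convex, so when it is nonempty \<^const>\<open>arg_min\<close> returns the unique optimizer.\<close>

definition search_direction ::
  "nat \<Rightarrow> (nat \<Rightarrow> real ^ 'n \<Rightarrow> real) \<Rightarrow> (nat \<Rightarrow> real) \<Rightarrow> real \<Rightarrow> (nat \<Rightarrow> real)
     \<Rightarrow> (nat \<Rightarrow> real ^ 'n) \<Rightarrow> real ^ 'n \<Rightarrow> real ^ 'n" where
  "search_direction m f \<epsilon> \<alpha> w g x =
     arg_min (subproblem_objective \<epsilon> g) (subproblem_feasible m f \<epsilon> \<alpha> w g x)"

definition step_accepted ::
  "nat \<Rightarrow> (nat \<Rightarrow> real ^ 'n \<Rightarrow> real) \<Rightarrow> real \<Rightarrow> real \<Rightarrow> real ^ 'n \<Rightarrow> real ^ 'n \<Rightarrow> real \<Rightarrow> bool" where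
  "step_accepted m f \<gamma>1 \<gamma>2 x u t \<longleftrightarrow>
     f 0 (x + t *\<^sub>R u) \<le> f 0 x - \<gamma>1 * t * (norm u)\<^sup>2 \<and>
     (\<forall>i\<in>{1..m}. f i (x + t *\<^sub>R u) \<le> (1 - \<gamma>2) * f i x)"

definition backtracking_step ::
  "nat \<Rightarrow> (nat \<Rightarrow> real ^ 'n \<Rightarrow> real) \<Rightarrow> real \<Rightarrow> real \<Rightarrow> real \<Rightarrow> real
     \<Rightarrow> real ^ 'n \<Rightarrow> real ^ 'n \<Rightarrow> real" where
  "backtracking_step m f \<beta> \<gamma>1 \<gamma>2 t_init x u =
     \<beta> ^ (LEAST j. step_accepted m f \<gamma>1 \<gamma>2 x u (\<beta> ^ j * t_init)) * t_init"

text \<open>The estimates \<open>g k i\<close> depend on the iteration \<open>k\<close>, not only on the point \<open>x k\<close>. Neither the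
  existence of an optimizer nor termination of the backtracking is built into this predicate: if
  one of them failed, \<^const>\<open>arg_min\<close> or \<^const>\<open>Least\<close> would return an unspecified value.\<close>

definition ssocp_sequence ::
  "nat \<Rightarrow> (nat \<Rightarrow> real ^ 'n \<Rightarrow> real) \<Rightarrow> (nat \<Rightarrow> real) \<Rightarrow> real \<Rightarrow> (nat \<Rightarrow> real)
     \<Rightarrow> real \<Rightarrow> real \<Rightarrow> real \<Rightarrow> real
     \<Rightarrow> (nat \<Rightarrow> nat \<Rightarrow> real ^ 'n) \<Rightarrow> (nat \<Rightarrow> real ^ 'n) \<Rightarrow> (nat \<Rightarrow> real ^ 'n) \<Rightarrow> bool" where
  "ssocp_sequence m f \<epsilon> \<alpha> w \<beta> \<gamma>1 \<gamma>2 t_init g x u \<longleftrightarrow>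
     (\<forall>k. u k = search_direction m f \<epsilon> \<alpha> w (g k) (x k) \<and>
          x (Suc k) = x k + backtracking_step m f \<beta> \<gamma>1 \<gamma>2 t_init (x k) (u k) *\<^sub>R u k)"

definition t_min ::
  "nat \<Rightarrow> (nat \<Rightarrow> real) \<Rightarrow> real \<Rightarrow> (nat \<Rightarrow> real) \<Rightarrow> real \<Rightarrow> real \<Rightarrow> real \<Rightarrow> real \<Rightarrow> real" where
  "t_min m L \<alpha> w \<beta> \<gamma>1 \<gamma>2 t_init =
     \<beta> * Min ({2 * (1 - \<gamma>1) / L 0} \<union> (\<lambda>i. 2 * w i / L i) ` {1..m} \<union> {\<gamma>2 / \<alpha>, t_init})"

end

theory Submission
  imports Defs
begin

text \<open>Comparing the optimizer \<open>u\<close> of the subproblem with the shrunken directions \<open>s *\<^sub>R u\<close>,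
  \<open>s \<rightarrow> 1\<close>, which are feasible because \<open>0\<close> is, gives
  \<open>g 0 \<bullet> u + \<epsilon> 0 * norm u \<le> - (norm u)\<^sup>2\<close>. By the descent lemma for functions with Lipschitz
  gradient, every step \<open>t\<close> below the minimum in the definition of \<open>t_min\<close> then passes the line search:
  the error terms absorb the gradient errors and the terms \<open>w i * (norm u)\<^sup>2\<close> the curvature. So
  backtracking stops at a step of length at least \<open>t_min\<close>, and the resulting decrease of the objective
  telescopes.\<close>

text \<open>Along the segment from \<open>x\<close> to \<open>x + h\<close>, subtract from
  \<open>f\<close> the linear term and the quadratic
  \<open>L / 2 * s\<^sup>2 * (norm h)\<^sup>2\<close>. By Cauchy-Schwarz and the Lipschitz bound on
  \<open>G\<close>, the derivative of the difference \<open>\<phi>\<close> is nonpositive on the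
  unit interval, so \<open>\<phi> 1 \<le> \<phi> 0\<close>.\<close>

lemma descent_lemma:
  fixes f :: "'a::real_inner \<Rightarrow> real"
  assumes D: "\<And>z. GDERIV f z :> G z" and lip: "L-lipschitz_on UNIV G"
  shows "f (x + h) \<le> f x + G x \<bullet> h + L / 2 * (norm h)\<^sup>2"
proof -
  define \<phi> where "\<phi> s = f (x + s *\<^sub>R h) - s * (G x \<bullet> h) - L / 2 * s\<^sup>2 * (norm h)\<^sup>2" for s :: real
  have "\<phi> 1 \<le> \<phi> 0"
  proof (rule DERIV_nonpos_imp_nonincreasing[of 0 1 \<phi>])
    fix s :: real assume s: "0 \<le> s" "s \<le> 1"
    let ?D = "G (x + s *\<^sub>R h) \<bullet> h - G x \<bullet> h - L * s * (norm h)\<^sup>2"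
    have "((\<lambda>s. f (x + s *\<^sub>R h)) has_derivative (\<lambda>r. (r *\<^sub>R h) \<bullet> G (x + s *\<^sub>R h))) (at s)"
      by (rule has_derivative_compose[of "\<lambda>s. x + s *\<^sub>R h"])
        (use D in \<open>auto intro!: derivative_eq_intros simp: gderiv_def\<close>)
    then have "((\<lambda>s. f (x + s *\<^sub>R h)) has_field_derivative (G (x + s *\<^sub>R h) \<bullet> h)) (at s)"
      by (simp add: has_field_derivative_def inner_commute mult_commute_abs)
    then have "(\<phi> has_field_derivative ?D) (at s)"
      unfolding \<phi>_def by (auto intro!: derivative_eq_intros)
    moreover have "?D \<le> 0"
    proof -
      have "(G (x + s *\<^sub>R h) - G x) \<bullet> h \<le> norm (G (x + s *\<^sub>R h) - G x) * norm h"
        by (rule norm_cauchy_schwarz)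
      also have "\<dots> \<le> (L * (s * norm h)) * norm h"
        using lipschitz_onD[OF lip, of "x + s *\<^sub>R h" x] s
        by (intro mult_right_mono) (auto simp: dist_norm)
      finally show ?thesis by (simp add: inner_diff_left power2_eq_square)
    qed
    ultimately show "\<exists>y. DERIV \<phi> s :> y \<and> y \<le> 0" by blast
  qed simp
  then show ?thesis by (simp add: \<phi>_def)
qed

text \<open>Each constraint function is at most its interpolation between \<open>u\<close> and
  \<open>0\<close>: the linear and norm terms scale by \<open>s\<close>, the quadratic one by
  \<open>s\<^sup>2 \<le> s\<close>. Its value at \<open>0\<close> is
  \<open>\<alpha> * f i x < 0\<close>.\<close>

lemma subproblem_feasible_scaleR:
  assumes x: "strictly_feasible m f x" and "\<alpha> > 0" and w: "\<And>i. i \<in> {1..m} \<Longrightarrow> w i > 0"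
    and u: "subproblem_feasible m f \<epsilon> \<alpha> w g x u" and s: "0 \<le> s" "s \<le> 1"
  shows "subproblem_feasible m f \<epsilon> \<alpha> w g x (s *\<^sub>R u)"
  unfolding subproblem_feasible_def
proof
  fix i assume i: "i \<in> {1..m}"
  let ?c = "g i \<bullet> u + \<epsilon> i * norm u"
  have "s\<^sup>2 \<le> s" using s by (simp add: power2_eq_square mult_left_le)
  then have "s\<^sup>2 * (w i * (norm u)\<^sup>2) \<le> s * (w i * (norm u)\<^sup>2)"
    using w[OF i] by (intro mult_right_mono) auto
  moreover have "s * (?c + \<alpha> * f i x + w i * (norm u)\<^sup>2) \<le> 0"
    using u i s by (intro mult_nonneg_nonpos) (auto simp: subproblem_feasible_def)
  moreover have "(1 - s) * (\<alpha> * f i x) \<le> 0"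
    using x i s \<open>\<alpha> > 0\<close> by (intro mult_nonneg_nonpos) (auto simp: strictly_feasible_def less_imp_le)
  ultimately show "g i \<bullet> (s *\<^sub>R u) + \<epsilon> i * norm (s *\<^sub>R u) + \<alpha> * f i x
      + w i * (norm (s *\<^sub>R u))\<^sup>2 \<le> 0"
    using s by (simp add: power_mult_distrib algebra_simps)
qed

text \<open>\<open>arg_min\<close> says something about its value only once a minimizer is
  exhibited. Weierstrass supplies one on a compact piece of the feasible set that contains
  \<open>0\<close>, and coercivity of the objective makes it global.\<close>

lemma search_direction_optimal:
  fixes g :: "nat \<Rightarrow> real ^ 'n" and w :: "nat \<Rightarrow> real"
  assumes x: "strictly_feasible m f x" and "\<alpha> > 0" and "\<epsilon> 0 \<ge> 0"
  defines "u \<equiv> search_direction m f \<epsilon> \<alpha> w g x"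
  shows "subproblem_feasible m f \<epsilon> \<alpha> w g x u"
    and "\<And>v. subproblem_feasible m f \<epsilon> \<alpha> w g x v \<Longrightarrow>
      subproblem_objective \<epsilon> g u \<le> subproblem_objective \<epsilon> g v"
proof -
  let ?F = "subproblem_feasible m f \<epsilon> \<alpha> w g x" and ?o = "subproblem_objective \<epsilon> g"
  \<comment> \<open>The radius comes from the lower bound
    \<open>norm y * (norm y / 2 - norm (g 0))\<close> for the objective at \<open>y\<close>: outside
    this ball it is nonnegative, hence no better than the value 0 at the feasible point
    \<open>0\<close>.\<close>
  let ?S = "cball 0 (2 * norm (g 0)) \<inter> {v. ?F v}"
  have zero: "?F 0"
    using x \<open>\<alpha> > 0\<close> by (auto simp: subproblem_feasible_def strictly_feasible_def
        mult_nonneg_nonpos less_imp_le)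
  have "{v. ?F v} = (\<Inter>i\<in>{1..m}. {v. g i \<bullet> v + \<epsilon> i * norm v + \<alpha> * f i x + w i * (norm v)\<^sup>2 \<le> 0})"
    by (auto simp: subproblem_feasible_def)
  moreover have "closed \<dots>"
    by (intro closed_INT ballI closed_Collect_le continuous_intros)
  ultimately have "compact ?S" by (simp add: compact_Int_closed)
  moreover have "0 \<in> ?S" using zero by simp
  moreover have "continuous_on ?S ?o"
    unfolding subproblem_objective_def by (intro continuous_intros)
  ultimately obtain v where v: "v \<in> ?S" and min: "\<And>y. y \<in> ?S \<Longrightarrow> ?o v \<le> ?o y"
    using continuous_attains_inf[of ?S ?o] by blast
  have le: "?o v \<le> ?o y" if y: "?F y" for y
  proof (cases "norm y \<le> 2 * norm (g 0)")
    case True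
    then show ?thesis using min y by simp
  next
    case False
    have "?o v \<le> ?o 0" using min \<open>0 \<in> ?S\<close> by blast
    also have "\<dots> = 0" by (simp add: subproblem_objective_def)
    also have "0 \<le> norm y * (norm y / 2 - norm (g 0))" using False by (intro mult_nonneg_nonneg) auto
    also have "\<dots> \<le> ?o y"
    proof -
      have "- (norm (g 0) * norm y) \<le> g 0 \<bullet> y"
        using Cauchy_Schwarz_ineq2[of "g 0" y] by linarith
      moreover have "0 \<le> \<epsilon> 0 * norm y" using \<open>\<epsilon> 0 \<ge> 0\<close> by simp
      ultimately show ?thesis
        by (simp add: subproblem_objective_def power2_eq_square algebra_simps)
    qed
    finally show ?thesis .
  qed
  have "?F u \<and> (\<forall>y. ?F y \<longrightarrow> ?o u \<le> ?o y)"
    unfolding u_def search_direction_def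
    by (rule arg_minI[of ?F v]) (use v le in \<open>auto simp: not_less\<close>)
  then show "?F u" "\<And>y. ?F y \<Longrightarrow> ?o u \<le> ?o y" by auto
qed

text \<open>This is the first-order optimality condition in the radial direction. It is obtained
  from difference quotients along the ray through \<open>u\<close>, so that the kink of the norm at
  \<open>0\<close> needs no separate treatment.\<close>

lemma search_direction_descent:
  fixes g :: "nat \<Rightarrow> real ^ 'n"
  assumes x: "strictly_feasible m f x" and \<alpha>: "\<alpha> > 0" and w: "\<And>i. i \<in> {1..m} \<Longrightarrow> w i > 0"
    and \<epsilon>: "\<epsilon> 0 \<ge> 0"
  defines "u \<equiv> search_direction m f \<epsilon> \<alpha> w g x"
  shows "g 0 \<bullet> u + \<epsilon> 0 * norm u \<le> - (norm u)\<^sup>2"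
proof -
  let ?c = "g 0 \<bullet> u + \<epsilon> 0 * norm u"
  note opt = search_direction_optimal[of m f x \<alpha> \<epsilon> w g, OF x \<alpha> \<epsilon>, folded u_def]
  have le: "(1 + s) / 2 * (norm u)\<^sup>2 + ?c \<le> 0" if s: "0 < s" "s < 1" for s
  proof -
    have "subproblem_objective \<epsilon> g u \<le> subproblem_objective \<epsilon> g (s *\<^sub>R u)"
      using s by (intro opt(2) subproblem_feasible_scaleR x \<alpha> w opt(1)) auto
    \<comment> \<open>The difference of the objective values at \<open>u\<close> and
      \<open>s *\<^sub>R u\<close> contains the factor \<open>1 - s\<close>, which is positive and
      can be cancelled before \<open>s\<close> tends to 1.\<close>
    then have "(1 - s) * ((1 + s) / 2 * (norm u)\<^sup>2 + ?c) \<le> 0"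
      using s by (simp add: subproblem_objective_def power_mult_distrib field_simps power2_eq_square)
    then show ?thesis using s by (simp add: mult_le_0_iff)
  qed
  have "((\<lambda>s. (1 + s) / 2 * (norm u)\<^sup>2 + ?c) \<longlongrightarrow> (1 + 1) / 2 * (norm u)\<^sup>2 + ?c) (at_left 1)"
    by (intro tendsto_intros) simp
  moreover have "\<forall>\<^sub>F s in at_left (1::real). 0 < s \<and> s < 1"
    using eventually_at_left_real[of 0 "1::real"] by (simp add: greaterThanLessThan_def)
  then have "\<forall>\<^sub>F s in at_left 1. (1 + s) / 2 * (norm u)\<^sup>2 + ?c \<le> 0"
    by eventually_elim (use le in auto)
  ultimately have "(1 + 1) / 2 * (norm u)\<^sup>2 + ?c \<le> 0"
    by (rule tendsto_upperbound) simp
  then show ?thesis by simp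
qed

text \<open>Each bound on \<open>t\<close> has its own task: the one with \<open>L 0\<close> leaves
  the fraction \<open>\<gamma>1\<close> of the decrease of the objective, those with
  \<open>L i\<close> let \<open>w i\<close> dominate the curvature of the constraints, and
  \<open>t \<le> \<gamma>2 / \<alpha>\<close> keeps the constraint values from approaching zero too
  fast.\<close>

lemma step_accepted_short:
  fixes f :: "nat \<Rightarrow> real ^ 'n \<Rightarrow> real"
  assumes grad: "\<And>i y. i \<in> {0..m} \<Longrightarrow> GDERIV (f i) y :> grad i y"
    and lip: "\<And>i. i \<in> {0..m} \<Longrightarrow> (L i)-lipschitz_on UNIV (grad i)"
    and L: "\<And>i. i \<in> {0..m} \<Longrightarrow> L i > 0"
    and est: "\<And>i. i \<in> {0..m} \<Longrightarrow> norm (grad i x - g i) \<le> \<epsilon> i"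
    and x: "strictly_feasible m f x"
    and \<alpha>: "\<alpha> > 0" and w: "\<And>i. i \<in> {1..m} \<Longrightarrow> w i > 0"
    and t: "t \<ge> 0" "t \<le> 2 * (1 - \<gamma>1) / L 0" "\<And>i. i \<in> {1..m} \<Longrightarrow> t \<le> 2 * w i / L i"
      "t \<le> \<gamma>2 / \<alpha>"
  defines "u \<equiv> search_direction m f \<epsilon> \<alpha> w g x"
  shows "step_accepted m f \<gamma>1 \<gamma>2 x u t"
proof -
  have \<epsilon>: "\<epsilon> 0 \<ge> 0" using order_trans[OF norm_ge_zero est[of 0]] by simp
  \<comment> \<open>One factor \<open>t\<close> is kept outside the curvature term, so that
    estimates for the direction \<open>u\<close> need only be multiplied by
    \<open>t\<close>.\<close>
  have model: "f i (x + t *\<^sub>R u) \<le> f i x + t * (g i \<bullet> u + \<epsilon> i * norm u) + t * (L i * t / 2 * (norm u)\<^sup>2)"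
    if i: "i \<in> {0..m}" for i
  proof -
    have "f i (x + t *\<^sub>R u) \<le> f i x + t * (grad i x \<bullet> u) + t * (L i * t / 2 * (norm u)\<^sup>2)"
      using descent_lemma[OF grad[OF i] lip[OF i], of x "t *\<^sub>R u"]
      by (simp add: power_mult_distrib power2_eq_square mult_ac)
    moreover have "(grad i x - g i) \<bullet> u \<le> \<epsilon> i * norm u"
      by (rule order_trans[OF norm_cauchy_schwarz mult_right_mono]) (use est[OF i] in auto)
    then have "t * (grad i x \<bullet> u) \<le> t * (g i \<bullet> u + \<epsilon> i * norm u)"
      using t(1) by (intro mult_left_mono) (auto simp: inner_diff_left)
    ultimately show ?thesis by linarith
  qed
  have "f 0 (x + t *\<^sub>R u) \<le> f 0 x - \<gamma>1 * t * (norm u)\<^sup>2"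
  proof -
    have "L 0 * t / 2 \<le> 1 - \<gamma>1" using t(2) L[of 0] by (simp add: field_simps)
    then have "L 0 * t / 2 * (norm u)\<^sup>2 \<le> (1 - \<gamma>1) * (norm u)\<^sup>2" by (intro mult_right_mono) auto
    moreover have "g 0 \<bullet> u + \<epsilon> 0 * norm u \<le> - (norm u)\<^sup>2"
      unfolding u_def by (rule search_direction_descent) (use x \<alpha> w \<epsilon> in auto)
    ultimately have "(g 0 \<bullet> u + \<epsilon> 0 * norm u) + L 0 * t / 2 * (norm u)\<^sup>2 \<le> - \<gamma>1 * (norm u)\<^sup>2"
      by (simp add: left_diff_distrib)
    from mult_left_mono[OF this t(1)] model[of 0] show ?thesis by (simp add: algebra_simps)
  qed
  moreover have "f i (x + t *\<^sub>R u) \<le> (1 - \<gamma>2) * f i x" if i: "i \<in> {1..m}" for i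
  proof -
    have i0: "i \<in> {0..m}" using i by simp
    have "L i * t / 2 \<le> w i" using t(3)[OF i] L[OF i0] by (simp add: field_simps)
    then have "L i * t / 2 * (norm u)\<^sup>2 \<le> w i * (norm u)\<^sup>2" by (intro mult_right_mono) auto
    moreover have "g i \<bullet> u + \<epsilon> i * norm u + \<alpha> * f i x + w i * (norm u)\<^sup>2 \<le> 0"
      using search_direction_optimal(1)[of m f x \<alpha> \<epsilon> w g, OF x \<alpha> \<epsilon>] i
      by (simp add: u_def subproblem_feasible_def)
    ultimately have "(g i \<bullet> u + \<epsilon> i * norm u) + L i * t / 2 * (norm u)\<^sup>2 \<le> - (\<alpha> * f i x)"
      by linarith
    from mult_left_mono[OF this t(1)] model[OF i0]
    have "f i (x + t *\<^sub>R u) \<le> f i x - (t * \<alpha>) * f i x" by (simp add: algebra_simps)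
    \<comment> \<open>As \<open>f i x\<close> is negative, the upper bound
      \<open>t * \<alpha> \<le> \<gamma>2\<close> turns into a lower bound after
      multiplication.\<close>
    moreover have "\<gamma>2 * f i x \<le> (t * \<alpha>) * f i x"
      using x i t(4) \<alpha> by (intro mult_right_mono_neg) (auto simp: strictly_feasible_def field_simps less_imp_le)
    ultimately show ?thesis by (simp add: left_diff_distrib)
  qed
  ultimately show ?thesis by (simp add: step_accepted_def)
qed

lemma backtracking_step_accepted:
  assumes short: "\<And>t. 0 < t \<Longrightarrow> t \<le> T \<Longrightarrow> step_accepted m f \<gamma>1 \<gamma>2 x u t"
    and T: "0 < T" "T \<le> t_init" and \<beta>: "0 < \<beta>" "\<beta> < 1"
  defines "t \<equiv> backtracking_step m f \<beta> \<gamma>1 \<gamma>2 t_init x u"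
  shows "step_accepted m f \<gamma>1 \<gamma>2 x u t" and "\<beta> * T \<le> t"
proof -
  define P where "P j = step_accepted m f \<gamma>1 \<gamma>2 x u (\<beta> ^ j * t_init)" for j
  define j where "j = (LEAST j. P j)"
  have t: "t = \<beta> ^ j * t_init" by (simp add: t_def backtracking_step_def j_def P_def)
  have t_init: "0 < t_init" using T by simp
  have short': "P k" if "\<beta> ^ k * t_init \<le> T" for k
    using that short \<beta> t_init by (simp add: P_def)
  \<comment> \<open>Some power of \<open>\<beta>\<close> brings the trial step below
    \<open>T\<close>, so the set of accepted exponents is nonempty and \<open>LEAST\<close> is
    meaningful.\<close>
  obtain k where "\<beta> ^ k < T / t_init"
    using real_arch_pow_inv[of "T / t_init" \<beta>] T t_init \<beta> by auto
  then have "P k" using t_init by (intro short') (simp add: field_simps)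
  then have "P j" unfolding j_def by (rule LeastI)
  then show "step_accepted m f \<gamma>1 \<gamma>2 x u t" by (simp add: P_def t)
  show "\<beta> * T \<le> t"
  \<comment> \<open>Either the initial step is accepted at once, or the preceding trial step was
    rejected and therefore exceeds \<open>T\<close>; the accepted step is \<open>\<beta>\<close>
    times that one.\<close>
  proof (cases j)
    case 0
    have "\<beta> * T \<le> 1 * T" using T \<beta> by (intro mult_right_mono) auto
    then show ?thesis using 0 T(2) by (simp add: t)
  next
    case (Suc l)
    then have "\<not> P l" using not_less_Least[of l P] by (simp add: j_def)
    then have "T \<le> \<beta> ^ l * t_init" using short' by force
    then show ?thesis using Suc t \<beta> by (simp add: mult.assoc)
  qed
qed

theorem theorem3:
  fixes m :: nat
    and f :: "nat \<Rightarrow> real ^ 'n \<Rightarrow> real"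
    and grad :: "nat \<Rightarrow> real ^ 'n \<Rightarrow> real ^ 'n"
    and g :: "nat \<Rightarrow> nat \<Rightarrow> real ^ 'n"
    and x u :: "nat \<Rightarrow> real ^ 'n"
    and L \<epsilon> w :: "nat \<Rightarrow> real"
    and \<alpha> \<beta> \<gamma>1 \<gamma>2 t_init :: real
  assumes grad: "\<And>i y. i \<in> {0..m} \<Longrightarrow> GDERIV (f i) y :> grad i y"
    and grad_continuous: "\<And>i. i \<in> {0..m} \<Longrightarrow> continuous_on UNIV (grad i)"
    and L_pos: "\<And>i. i \<in> {0..m} \<Longrightarrow> L i > 0"
    and grad_lipschitz: "\<And>i. i \<in> {0..m} \<Longrightarrow> (L i)-lipschitz_on UNIV (grad i)"
    and bounded_below: "bdd_below (f 0 ` feasible_set m f)"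
    and attained: "\<exists>y\<in>feasible_set m f. f 0 y = opt_value m f"
    and mfcq: "mfcq m f grad"
    and \<epsilon>_pos: "\<And>i. i \<in> {0..m} \<Longrightarrow> \<epsilon> i > 0"
    and t_init_pos: "t_init > 0"
    and \<alpha>_pos: "\<alpha> > 0"
    and w_pos: "\<And>i. i \<in> {1..m} \<Longrightarrow> w i > 0"
    and \<beta>: "\<beta> \<in> {0<..<1}"
    and \<gamma>1: "\<gamma>1 \<in> {0<..<1}"
    and \<gamma>2: "\<gamma>2 \<in> {0<..<1}"
    and start: "strictly_feasible m f (x 0)"
    and run: "ssocp_sequence m f \<epsilon> \<alpha> w \<beta> \<gamma>1 \<gamma>2 t_init g x u"
    and estimates: "\<And>k i. i \<in> {0..m} \<Longrightarrow> norm (grad i (x k) - g k i) \<le> \<epsilon> i"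
  shows "(\<forall>k. strictly_feasible m f (x k)) \<and>
    (\<forall>i\<in>{1..m}. \<forall>K. f i (x K) \<le> (1 - \<gamma>2) ^ K * f i (x 0) \<and> (1 - \<gamma>2) ^ K * f i (x 0) < 0) \<and>
    (\<forall>K\<ge>1. 1 / real K * (\<Sum>k<K. (norm (u k))\<^sup>2)
       \<le> (f 0 (x 0) - opt_value m f) / (\<gamma>1 * t_min m L \<alpha> w \<beta> \<gamma>1 \<gamma>2 t_init * real K)) \<and>
    summable (\<lambda>k. (norm (u k))\<^sup>2) \<and>
    (\<Sum>k. (norm (u k))\<^sup>2)
       \<le> (f 0 (x 0) - opt_value m f) / (\<gamma>1 * t_min m L \<alpha> w \<beta> \<gamma>1 \<gamma>2 t_init) \<and>
    (\<lambda>k. norm (u k)) \<longlonglongrightarrow> 0"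
proof -
  define T where
    "T = Min ({2 * (1 - \<gamma>1) / L 0} \<union> (\<lambda>i. 2 * w i / L i) ` {1..m} \<union> {\<gamma>2 / \<alpha>, t_init})"
  define \<tau> where "\<tau> = t_min m L \<alpha> w \<beta> \<gamma>1 \<gamma>2 t_init"
  have \<tau>: "\<tau> = \<beta> * T" by (simp add: \<tau>_def t_min_def T_def)
  have T_pos: "0 < T"
    unfolding T_def using L_pos w_pos \<gamma>1 \<gamma>2 \<alpha>_pos t_init_pos by (subst Min_gr_iff) auto
  have T_le: "T \<le> a"
    if "a \<in> {2 * (1 - \<gamma>1) / L 0} \<union> (\<lambda>i. 2 * w i / L i) ` {1..m} \<union> {\<gamma>2 / \<alpha>, t_init}" for a
    unfolding T_def by (rule Min_le[OF _ that]) simp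
  have \<tau>_pos: "0 < \<tau>" using \<tau> T_pos \<beta> by simp
  \<comment> \<open>Strict feasibility stays a premise here, since it is itself established by
    induction from the second of these inequalities.\<close>
  have step: "f 0 (x (Suc k)) \<le> f 0 (x k) - \<gamma>1 * \<tau> * (norm (u k))\<^sup>2"
    "\<And>i. i \<in> {1..m} \<Longrightarrow> f i (x (Suc k)) \<le> (1 - \<gamma>2) * f i (x k)"
    if sf: "strictly_feasible m f (x k)" for k
  proof -
    define t where "t = backtracking_step m f \<beta> \<gamma>1 \<gamma>2 t_init (x k) (u k)"
    have u: "u k = search_direction m f \<epsilon> \<alpha> w (g k) (x k)" and x_Suc: "x (Suc k) = x k + t *\<^sub>R u k"
      using run by (simp_all add: ssocp_sequence_def t_def)
    have short: "step_accepted m f \<gamma>1 \<gamma>2 (x k) (u k) s" if s: "0 < s" "s \<le> T" for s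
      unfolding u
    proof (rule step_accepted_short[OF grad grad_lipschitz L_pos estimates sf \<alpha>_pos w_pos])
      show "s \<le> 2 * (1 - \<gamma>1) / L 0" "s \<le> \<gamma>2 / \<alpha>" using T_le s by force+
      show "s \<le> 2 * w i / L i" if "i \<in> {1..m}" for i
        by (rule order_trans[OF s(2) T_le]) (use that in auto)
    qed (use s in auto)
    have "T \<le> t_init" by (rule T_le) simp
    then have acc: "step_accepted m f \<gamma>1 \<gamma>2 (x k) (u k) t" and "\<tau> \<le> t"
      using backtracking_step_accepted[OF short T_pos] \<beta> by (simp_all add: t_def \<tau>)
    then have "\<gamma>1 * \<tau> * (norm (u k))\<^sup>2 \<le> \<gamma>1 * t * (norm (u k))\<^sup>2"
      using \<gamma>1 by (intro mult_right_mono mult_left_mono) auto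
    with acc show "f 0 (x (Suc k)) \<le> f 0 (x k) - \<gamma>1 * \<tau> * (norm (u k))\<^sup>2"
      by (simp add: step_accepted_def x_Suc)
    show "f i (x (Suc k)) \<le> (1 - \<gamma>2) * f i (x k)" if "i \<in> {1..m}" for i
      using acc that by (simp add: step_accepted_def x_Suc)
  qed
  have sf: "strictly_feasible m f (x k)" for k
  proof (induction k)
    case (Suc k)
    have "(1 - \<gamma>2) * f i (x k) < 0" if "i \<in> {1..m}" for i
      using Suc that \<gamma>2 by (simp add: strictly_feasible_def mult_pos_neg)
    then show ?case unfolding strictly_feasible_def using step(2)[OF Suc] by fastforce
  qed (rule start)
  have rate: "f i (x K) \<le> (1 - \<gamma>2) ^ K * f i (x 0)" if i: "i \<in> {1..m}" for i K
  proof (induction K)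
    case (Suc K)
    have "f i (x (Suc K)) \<le> (1 - \<gamma>2) * f i (x K)" by (rule step(2)[OF sf i])
    also have "\<dots> \<le> (1 - \<gamma>2) * ((1 - \<gamma>2) ^ K * f i (x 0))"
      using Suc \<gamma>2 by (intro mult_left_mono) auto
    finally show ?case by (simp add: mult.assoc)
  qed simp
  have neg: "(1 - \<gamma>2) ^ K * f i (x 0) < 0" if "i \<in> {1..m}" for i K
    using start that \<gamma>2 by (intro mult_pos_neg) (auto simp: strictly_feasible_def)
  define B where "B = (f 0 (x 0) - opt_value m f) / (\<gamma>1 * \<tau>)"
  have bound: "(\<Sum>k<K. (norm (u k))\<^sup>2) \<le> B" for K
  proof -
    \<comment> \<open>The guaranteed decreases telescope over the first \<open>K\<close>
      iterations.\<close>
    have "\<gamma>1 * \<tau> * (\<Sum>k<K. (norm (u k))\<^sup>2) \<le> f 0 (x 0) - f 0 (x K)"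
    proof (induction K)
      case (Suc K)
      then show ?case using step(1)[OF sf, of K] by (simp add: distrib_left)
    qed simp
    \<comment> \<open>The iterate is feasible, so its objective value lies above the infimum;
      boundedness below makes \<open>INF\<close> a true lower bound.\<close>
    also have "opt_value m f \<le> f 0 (x K)"
      unfolding opt_value_def using sf[of K]
      by (intro cINF_lower bounded_below) (force simp: feasible_set_def strictly_feasible_def)
    then have "f 0 (x 0) - f 0 (x K) \<le> f 0 (x 0) - opt_value m f" by simp
    finally show ?thesis
      using \<gamma>1 \<tau>_pos by (simp add: B_def pos_le_divide_eq mult.commute)
  qed
  have avg: "1 / real K * (\<Sum>k<K. (norm (u k))\<^sup>2)
      \<le> (f 0 (x 0) - opt_value m f) / (\<gamma>1 * \<tau> * real K)" if "K \<ge> 1" for K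
    using divide_right_mono[OF bound[of K], of "real K"] by (simp add: B_def)
  have summable: "summable (\<lambda>k. (norm (u k))\<^sup>2)"
    by (rule summableI_nonneg_bounded[of _ B]) (use bound in auto)
  have sum: "(\<Sum>k. (norm (u k))\<^sup>2) \<le> B"
    by (rule suminf_le_const[OF summable]) (rule bound)
  \<comment> \<open>The terms of a convergent series tend to 0, and continuity of the square root
    passes from the squared norms to the norms.\<close>
  have "(\<lambda>k. sqrt ((norm (u k))\<^sup>2)) \<longlonglongrightarrow> sqrt 0"
    by (intro tendsto_real_sqrt summable_LIMSEQ_zero summable)
  then have "(\<lambda>k. norm (u k)) \<longlonglongrightarrow> 0" by simp
  with sf rate neg avg summable sum show ?thesis by (simp add: B_def \<tau>_def)
qed

end
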